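(* For any action of an inverse semigroup $S$ on a locally compact Hausdorff space $X$ such that each $X_e$ ($e\in E(S)$) is compact, the KS-groupoid $S\ltimes X^{\mathrm{KS}}$ is Hausdorff if and only if $S^X=\{s\in S\mid X_{s^*s}\neq\emptyset\}$ is a weak semilattice.
   Context: An inverse semigroup is a semigroup $S$ in which every $s$ has a unique $s^*$ with $ss^*s=s$, $s^*ss^*=s^*$; $E(S)$ is its commutative subsemigroup of idempotents; $s\le t$ means $ts^*s=s$; $t^\downarrow=\{s\in S\mid s\le t\}$. A subset $P\subset S$ is a weak semilattice if for any $s,t\in P$ there is a finite subset $F\subset P\cap s^\downarrow\cap t^\downarrow$ with $P\cap s^\downarrow\cap t^\downarrow\subset\bigcup_{u\in F}u^\downarrow$. An action $\theta$ of $S$ on a topological space $X$ is a semigroup homomorphism $s\mapsto\theta_s$ from $S$ to the inverse semigroup of partial bijections of $X$ (bijections between subsets, composed on the largest possible domain) such that, writing $X_e$ for the subset on which $\theta_e$ ($e\in E(S)$) is the identity (so $\theta_s$ is a bijection $X_{s^*s}\to X_{ss^*}$): each $X_e$ is open, each $\theta_s\colon X_{s^*s}\to X_{ss^*}$ is continuous, and $\bigcup_{e\in E(S)}X_e=X$. The space $X^{\mathrm{KS}}$: let $\widetilde{X_e}=X_e\sqcup\{\infty_e\}$ be the one-point compactification of $X_e$ (a point $\infty_e$ is added even when $X_e$ is compact). Let $\widetilde{X^{\mathrm{KS}}}$ be the set of $\tau\in\prod_{e\in E(S)}\widetilde{X_e}$ such that (1) if $e_1\le e_2$ and $\tau(e_1)\ne\infty_{e_1}$,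 then $\tau(e_2)=\tau(e_1)$; (2) if $\tau(e_1)\neq\infty_{e_1}$ and $\tau(e_2)\neq\infty_{e_2}$, then $\tau(e_1e_2)\neq\infty_{e_1e_2}$; with the topology induced from the product topology. Set $X^{\mathrm{KS}}=\widetilde{X^{\mathrm{KS}}}\setminus\{\infty\}$, $\infty=(\infty_e)_e$; it is locally compact Hausdorff. $S$ acts on $X^{\mathrm{KS}}$ by $X^{\mathrm{KS}}_e=\{\tau\in X^{\mathrm{KS}}\mid\tau(e)\ne\infty_e\}$ and $\theta^{\mathrm{KS}}_s\colon X^{\mathrm{KS}}_{s^*s}\to X^{\mathrm{KS}}_{ss^*}$, $\theta^{\mathrm{KS}}_s(\tau)(e)=\theta_{es}(\tau(s^*es))$ if $\tau(s^*es)\neq\infty_{s^*es}$ and $\infty_e$ otherwise. Transformation groupoid: for an action $\theta$ of $S$ on a locally compact Hausdorff space $Z$, $S\ltimes Z$ is the set of classes $[s,z]$ of pairs $(s,z)$, $z\in Z_{s^*s}$, under $(s,z)\sim(t,w)$ iff $z=w$ and $se=te$, $z\in Z_e$ for some $e\in E(S)$; unit space $\{[e,z]\}\cong Z$, $d([s,z])=z$, $r([s,z])=\theta_s(z)$, $[t,\theta_s(z)][s,z]=[ts,z]$, $[s,z]^{-1}=[s^*,\theta_s(z)]$; basis of open sets $[s,U]=\{[s,z]\mid z\in U\}$, $U\subset Z_{s^*s}$ open. The KS-groupoid is the transformation groupoid $S\ltimes X^{\mathrm{KS}}$ of the action $\theta^{\mathrm{KS}}=(\theta^{\mathrm{KS}}_s)_{s\in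 S}$ of $S$ on $Z=X^{\mathrm{KS}}$, with $Z_e=X^{\mathrm{KS}}_e$ for $e\in E(S)$. *)

theory Defs
  imports "HOL-Analysis.Analysis"
begin

section \<open>Inverse semigroups\<close>

class inverse_semigroup = semigroup_mult +
  assumes ex1_inverse: "\<exists>!t. s * t * s = s \<and> t * s * t = t"

definition star :: "'s::inverse_semigroup \<Rightarrow> 's" ("_\<^sup>\<star>" [1000] 999)
  where "s\<^sup>\<star> = (THE t. s * t * s = s \<and> t * s * t = t)"

definition idempotents :: "'s::inverse_semigroup set"
  where "idempotents = {e. e * e = e}"

definition natural_le :: "'s::inverse_semigroup \<Rightarrow> 's \<Rightarrow> bool"  (infix "\<preceq>" 50)
  where "s \<preceq> t \<longleftrightarrow> t * s\<^sup>\<star> * s = s"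

definition down :: "'s::inverse_semigroup \<Rightarrow> 's set"
  where "down t = {s. s \<preceq> t}"

definition weak_semilattice :: "'s::inverse_semigroup set \<Rightarrow> bool"
  where "weak_semilattice P \<longleftrightarrow>
    (\<forall>s\<in>P. \<forall>t\<in>P. \<exists>F. finite F \<and> F \<subseteq> P \<inter> down s \<inter> down t \<and>
        P \<inter> down s \<inter> down t \<subseteq> (\<Union>u\<in>F. down u))"

lemma star_unique:
  assumes "s * t * s = s" "t * s * t = t"
  shows "s\<^sup>\<star> = t"
  unfolding star_def using ex1_inverse[of s] assms by (intro the1_equality) auto

lemma star_mult_self: "s * s\<^sup>\<star> * s = s" and self_mult_star: "s\<^sup>\<star> * s * s\<^sup>\<star> = s\<^sup>\<star>"
  using theI'[OF ex1_inverse[of s]] unfolding star_def by blast+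

lemma star_idempotent: "e \<in> idempotents \<Longrightarrow> e\<^sup>\<star> = e"
  by (rule star_unique) (simp_all add: idempotents_def)

lemma idempotent_mult:
  assumes "e \<in> idempotents" "f \<in> idempotents"
  shows "e * f \<in> idempotents"
proof -
  have ee: "e * e = e" "f * f = f" using assms by (auto simp: idempotents_def)
  have ee': "e * (e * x) = e * x" "f * (f * x) = f * x" for x
    using ee by (metis mult.assoc)+
  define x where "x = (e * f)\<^sup>\<star>"
  have x: "e * f * x * (e * f) = e * f" "x * (e * f) * x = x"
    unfolding x_def by (rule star_mult_self self_mult_star)+
  have x': "e * (f * (x * (e * f))) = e * f" "x * (e * (f * x)) = x"
    using x by (simp_all add: mult.assoc)
  have x'': "x * (e * (f * (x * y))) = x * y" for y
    using x'(2) by (metis mult.assoc)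
  have "(e * f)\<^sup>\<star> = f * x * e"
    by (rule star_unique) (simp_all add: mult.assoc ee' x' x'')
  then have x_eq: "x = f * x * e" by (simp add: x_def)
  have "x * x = (f * x * e) * (f * x * e)" using x_eq by simp
  also have "\<dots> = f * x * e" by (simp add: mult.assoc x'')
  finally have "x * x = x" using x_eq by simp
  then have "x\<^sup>\<star> = x" by (intro star_unique) simp_all
  moreover have "x\<^sup>\<star> = e * f" using x by (intro star_unique) (auto simp: mult.assoc)
  ultimately show ?thesis using \<open>x * x = x\<close> by (simp add: idempotents_def)
qed

lemma idempotent_commute:
  assumes "e \<in> idempotents" "f \<in> idempotents"
  shows "e * f = f * e"
proof -
  have ee: "e * e = e" "f * f = f" using assms by (auto simp: idempotents_def)
  have ee': "e * (e * x) = e * x" "f * (f * x) = f * x" for x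
    using ee by (metis mult.assoc)+
  have i: "e * f * (e * f) = e * f" "f * e * (f * e) = f * e"
    using idempotent_mult assms by (auto simp: idempotents_def)
  have "(e * f)\<^sup>\<star> = f * e"
    by (rule star_unique) (use i in \<open>simp_all add: mult.assoc ee'\<close>)
  moreover have "(e * f)\<^sup>\<star> = e * f"
    using idempotent_mult[OF assms] by (rule star_idempotent)
  ultimately show ?thesis by simp
qed


section \<open>Actions\<close>

text \<open>A partial bijection is a partial function, so that \<open>\<circ>\<^sub>m\<close> is the composition on the
  largest possible domain.\<close>

definition partial_bijection :: "'x set \<Rightarrow> ('x \<rightharpoonup> 'x) \<Rightarrow> bool"
  where "partial_bijection A f \<longleftrightarrow> dom f \<subseteq> A \<and> ran f \<subseteq> A \<and> inj_on f (dom f)"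

definition act_dom :: "('s::inverse_semigroup \<Rightarrow> 'x \<rightharpoonup> 'x) \<Rightarrow> 's \<Rightarrow> 'x set"
  where "act_dom \<theta> e = {x. \<theta> e x = Some x}"

definition semigroup_action ::
    "'x topology \<Rightarrow> ('s::inverse_semigroup \<Rightarrow> 'x \<rightharpoonup> 'x) \<Rightarrow> bool"
  where "semigroup_action X \<theta> \<longleftrightarrow>
    (\<forall>s. partial_bijection (topspace X) (\<theta> s)) \<and>
    (\<forall>s t. \<theta> (s * t) = \<theta> s \<circ>\<^sub>m \<theta> t) \<and>
    (\<forall>e\<in>idempotents. openin X (act_dom \<theta> e)) \<and>
    (\<forall>s. continuous_map (subtopology X (act_dom \<theta> (s\<^sup>\<star> * s)))
                        (subtopology X (act_dom \<theta> (s * s\<^sup>\<star>))) (\<lambda>x. the (\<theta> s x))) \<and>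
    (\<Union>e\<in>idempotents. act_dom \<theta> e) = topspace X"


section \<open>Transformation groupoids\<close>

record ('g, 'z) topological_groupoid =
  unit_space :: "'z topology"
  arrow_space :: "'g topology"
  unit_arrow :: "'z \<Rightarrow> 'g"
  source_map :: "'g \<Rightarrow> 'z"
  range_map :: "'g \<Rightarrow> 'z"
  arrow_mult :: "'g \<Rightarrow> 'g \<Rightarrow> 'g"
  arrow_inverse :: "'g \<Rightarrow> 'g"

definition germ_pairs :: "('s::inverse_semigroup \<Rightarrow> 'z \<rightharpoonup> 'z) \<Rightarrow> ('s \<times> 'z) set"
  where "germ_pairs \<theta> = {(s, z). z \<in> act_dom \<theta> (s\<^sup>\<star> * s)}"

definition germ_rel :: "('s::inverse_semigroup \<Rightarrow> 'z \<rightharpoonup> 'z) \<Rightarrow> (('s \<times> 'z) \<times> ('s \<times> 'z)) set"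
  where "germ_rel \<theta> = {((s, z), (t, w)). (s, z) \<in> germ_pairs \<theta> \<and> (t, w) \<in> germ_pairs \<theta> \<and>
     z = w \<and> (\<exists>e\<in>idempotents. s * e = t * e \<and> z \<in> act_dom \<theta> e)}"

definition germ :: "('s::inverse_semigroup \<Rightarrow> 'z \<rightharpoonup> 'z) \<Rightarrow> 's \<Rightarrow> 'z \<Rightarrow> ('s \<times> 'z) set"
  where "germ \<theta> s z = germ_rel \<theta> `` {(s, z)}"

text \<open>For an action the sets \<open>[s, U]\<close> form a basis, so the topology generated by them as a subbasis is the
  one having them as a basis.\<close>

definition germ_topology ::
    "'z topology \<Rightarrow> ('s::inverse_semigroup \<Rightarrow> 'z \<rightharpoonup> 'z) \<Rightarrow> ('s \<times> 'z) set topology"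
  where "germ_topology Z \<theta> = topology_generated_by
    {germ \<theta> s ` U | s U. openin Z U \<and> U \<subseteq> act_dom \<theta> (s\<^sup>\<star> * s)}"

definition transformation_groupoid ::
    "'z topology \<Rightarrow> ('s::inverse_semigroup \<Rightarrow> 'z \<rightharpoonup> 'z) \<Rightarrow> (('s \<times> 'z) set, 'z) topological_groupoid"
  where "transformation_groupoid Z \<theta> = \<lparr>
    unit_space = Z,
    arrow_space = germ_topology Z \<theta>,
    unit_arrow = (\<lambda>z. THE g. \<exists>e\<in>idempotents. z \<in> act_dom \<theta> e \<and> g = germ \<theta> e z),
    source_map = (\<lambda>g. THE z. \<exists>s. (s, z) \<in> germ_pairs \<theta> \<and> g = germ \<theta> s z),
    range_map = (\<lambda>g. THE w. \<exists>s z. (s, z) \<in> germ_pairs \<theta> \<and> g = germ \<theta> s z \<and> \<theta> s z = Some w),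
    arrow_mult = (\<lambda>g h. THE k. \<exists>t s z w. (s, z) \<in> germ_pairs \<theta> \<and> \<theta> s z = Some w \<and>
        (t, w) \<in> germ_pairs \<theta> \<and> g = germ \<theta> t w \<and> h = germ \<theta> s z \<and> k = germ \<theta> (t * s) z),
    arrow_inverse = (\<lambda>g. THE h. \<exists>s z w. (s, z) \<in> germ_pairs \<theta> \<and> \<theta> s z = Some w \<and>
        g = germ \<theta> s z \<and> h = germ \<theta> (s\<^sup>\<star>) w)\<rparr>"


section \<open>The KS-groupoid\<close>

text \<open>In \<open>Alexandroff_compactification\<close> the added point is \<open>None\<close>; it is also added, as an
  isolated point, when the space is compact.\<close>

definition KS_product ::
    "'x topology \<Rightarrow> ('s::inverse_semigroup \<Rightarrow> 'x \<rightharpoonup> 'x) \<Rightarrow> ('s \<Rightarrow> 'x option) topology"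
  where "KS_product X \<theta> = product_topology
    (\<lambda>e. Alexandroff_compactification (subtopology X (act_dom \<theta> e))) idempotents"

definition KS_tilde ::
    "'x topology \<Rightarrow> ('s::inverse_semigroup \<Rightarrow> 'x \<rightharpoonup> 'x) \<Rightarrow> ('s \<Rightarrow> 'x option) set"
  where "KS_tilde X \<theta> = {\<tau> \<in> topspace (KS_product X \<theta>).
    (\<forall>e\<^sub>1\<in>idempotents. \<forall>e\<^sub>2\<in>idempotents. e\<^sub>1 \<preceq> e\<^sub>2 \<and> \<tau> e\<^sub>1 \<noteq> None \<longrightarrow> \<tau> e\<^sub>2 = \<tau> e\<^sub>1) \<and>
    (\<forall>e\<^sub>1\<in>idempotents. \<forall>e\<^sub>2\<in>idempotents. \<tau> e\<^sub>1 \<noteq> None \<and> \<tau> e\<^sub>2 \<noteq> None \<longrightarrow> \<tau> (e\<^sub>1 * e\<^sub>2) \<noteq> None)}"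

definition KS_infinity :: "'s::inverse_semigroup \<Rightarrow> 'x option"
  where "KS_infinity = (\<lambda>e\<in>idempotents. None)"

definition KS_space ::
    "'x topology \<Rightarrow> ('s::inverse_semigroup \<Rightarrow> 'x \<rightharpoonup> 'x) \<Rightarrow> ('s \<Rightarrow> 'x option) topology"
  where "KS_space X \<theta> = subtopology (KS_product X \<theta>) (KS_tilde X \<theta> - {KS_infinity})"

definition KS_action ::
    "'x topology \<Rightarrow> ('s::inverse_semigroup \<Rightarrow> 'x \<rightharpoonup> 'x) \<Rightarrow> 's \<Rightarrow> ('s \<Rightarrow> 'x option) \<rightharpoonup> ('s \<Rightarrow> 'x option)"
  where "KS_action X \<theta> s \<tau> =
    (if \<tau> \<in> topspace (KS_space X \<theta>) \<and> \<tau> (s\<^sup>\<star> * s) \<noteq> None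
     then Some (\<lambda>e\<in>idempotents.
       case \<tau> (s\<^sup>\<star> * e * s) of None \<Rightarrow> None | Some x \<Rightarrow> \<theta> (e * s) x)
     else None)"

definition KS_groupoid ::
    "'x topology \<Rightarrow> ('s::inverse_semigroup \<Rightarrow> 'x \<rightharpoonup> 'x) \<Rightarrow>
      (('s \<times> ('s \<Rightarrow> 'x option)) set, 's \<Rightarrow> 'x option) topological_groupoid"
  where "KS_groupoid X \<theta> = transformation_groupoid (KS_space X \<theta>) (KS_action X \<theta>)"

lemma act_dom_KS_action:
  assumes e: "e \<in> idempotents"
  shows "act_dom (KS_action X \<theta>) e = {\<tau> \<in> topspace (KS_space X \<theta>). \<tau> e \<noteq> None}"
proof -
  have ee: "e\<^sup>\<star> * e = e" using e by (simp add: star_idempotent) (simp add: idempotents_def)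
  have "(\<lambda>f\<in>idempotents. case \<tau> (e * f * e) of None \<Rightarrow> None | Some x \<Rightarrow> \<theta> (f * e) x) = \<tau>"
    if \<tau>: "\<tau> \<in> topspace (KS_space X \<theta>)" and ne: "\<tau> e \<noteq> None" for \<tau>
  proof
    fix f
    have PiE: "\<tau> \<in> topspace (KS_product X \<theta>)" and T: "\<tau> \<in> KS_tilde X \<theta>"
      using \<tau> by (auto simp: KS_space_def)
    show "(\<lambda>f\<in>idempotents. case \<tau> (e * f * e) of None \<Rightarrow> None | Some x \<Rightarrow> \<theta> (f * e) x) f = \<tau> f"
    proof (cases "f \<in> idempotents")
      case False
      then show ?thesis using PiE by (auto simp: KS_product_def PiE_def extensional_def)
    next
      case f: True
      have fe: "f * e \<in> idempotents" using idempotent_mult e f by blast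
      have efe: "e * f * e = f * e"
        using idempotent_commute[OF e f] e by (simp add: idempotents_def mult.assoc)
      have le: "f * e \<preceq> f"
      proof -
        have "f * f = f" "f * e * (f * e) = f * e" using f fe by (simp_all add: idempotents_def)
        then have "f * (f * e) * (f * e) = f * e" by (simp add: mult.assoc[symmetric])
        then show ?thesis by (simp add: natural_le_def star_idempotent[OF fe])
      qed
      have up: "\<tau> f = \<tau> (f * e)" if "\<tau> (f * e) \<noteq> None"
        using T le fe f that unfolding KS_tilde_def by blast
      have dn: "\<tau> (f * e) \<noteq> None" if "\<tau> f \<noteq> None"
        using T e f that ne unfolding KS_tilde_def by blast
      have mem: "\<theta> (f * e) x = Some x" if "\<tau> (f * e) = Some x" for x
      proof -
        have "\<tau> (f * e) \<in> topspace (Alexandroff_compactification (subtopology X (act_dom \<theta> (f * e))))"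
          using PiE fe by (auto simp: KS_product_def)
        then show ?thesis using that by (auto simp: act_dom_def)
      qed
      show ?thesis
      proof (cases "\<tau> (f * e)")
        case None
        with dn have "\<tau> f = None" by blast
        with None f efe show ?thesis by simp
      next
        case (Some x)
        with up have "\<tau> f = Some x" by simp
        with Some mem f efe show ?thesis by simp
      qed
    qed
  qed
  then show ?thesis
    unfolding act_dom_def KS_action_def using ee by (auto simp: star_idempotent[OF e])
qed

end

theory Submission
  imports Defs
begin

text \<open>
  Write \<open>Z = X\<^sup>K\<^sup>S\<close>. Two germs of \<open>s\<close> and \<open>t\<close> at a common base point \<open>z\<close> coincide exactly when
  some \<open>u\<close> below both \<open>s\<close> and \<open>t\<close> is defined at \<open>z\<close>; so they coincide on the open set
  \<open>A(s,t) = \<Union>{Z\<^bsub>u\<^sup>\<star>u\<^esub> | u \<preceq> s, u \<preceq> t}\<close>. Germs over different base points are separated already by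
  \<open>Z\<close>, so the only obstruction to being Hausdorff is a base point in the boundary of \<open>A(s,t)\<close>:
  the groupoid is Hausdorff if and only if every \<open>A(s,t)\<close> is closed in
  \<open>Z\<^bsub>s\<^sup>\<star>s\<^esub> \<inter> Z\<^bsub>t\<^sup>\<star>t\<^esub>\<close> (\<open>Hausdorff_germ_topology_iff\<close>).

  If every \<open>X\<^sub>e\<close> is compact, then \<open>\<infinity>\<^sub>e\<close> is isolated in the compactification of \<open>X\<^sub>e\<close>, and this
  makes every \<open>Z\<^sub>e\<close> both closed in \<open>Z\<close> and compact (\<open>closedin_KS_dom\<close>, \<open>compactin_KS_dom\<close>).
  A finite union of sets \<open>Z\<^bsub>u\<^sup>\<star>u\<^esub>\<close> is therefore closed; conversely, if \<open>A(s,t)\<close> is closed in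
  the compact set \<open>Z\<^bsub>s\<^sup>\<star>s\<^esub> \<inter> Z\<^bsub>t\<^sup>\<star>t\<^esub>\<close>, then finitely many of the open sets
  \<open>Z\<^bsub>u\<^sup>\<star>u\<^esub>\<close> cover it. So closedness of \<open>A(s,t)\<close> means that it is a finite union of sets
  \<open>Z\<^bsub>u\<^sup>\<star>u\<^esub>\<close>, where those \<open>u\<close> with \<open>X\<^bsub>u\<^sup>\<star>u\<^esub> = \<emptyset>\<close> contribute nothing.

  It remains to read such a cover as a statement about the order. A point of \<open>Z\<close> is a filter of
  idempotents together with a point lying in all of their domains. For \<open>x \<in> X\<^bsub>v\<^sup>\<star>v\<^esub>\<close> the
  principal filter at \<open>v\<^sup>\<star>v\<close> together with \<open>x\<close> is a point of \<open>Z\<^bsub>v\<^sup>\<star>v\<^esub>\<close> that lies in no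
  \<open>Z\<^sub>e\<close> except those with \<open>v\<^sup>\<star>v \<preceq> e\<close> (\<open>principal_point\<close>). If it lies in \<open>Z\<^bsub>u\<^sup>\<star>u\<^esub>\<close> and
  \<open>u, v \<preceq> s\<close>, then \<open>v \<preceq> u\<close>. Hence finitely many \<open>Z\<^bsub>u\<^sup>\<star>u\<^esub>\<close> cover \<open>A(s,t)\<close> exactly when the
  corresponding \<open>u\<close> dominate all common lower bounds of \<open>s\<close> and \<open>t\<close> in \<open>S\<^sup>X\<close>, which is the weak
  semilattice condition.
\<close>

section \<open>The natural partial order of an inverse semigroup\<close>

lemma source_idempotent: "s\<^sup>\<star> * s \<in> idempotents"
proof -
  have "s\<^sup>\<star> * s * (s\<^sup>\<star> * s) = s\<^sup>\<star> * s * s\<^sup>\<star> * s" by (simp add: mult.assoc)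
  then show ?thesis by (simp add: idempotents_def self_mult_star)
qed

lemma source_mult_idempotent:
  assumes e: "e \<in> idempotents"
  shows "(s * e)\<^sup>\<star> * (s * e) = s\<^sup>\<star> * s * e"
proof -
  have ee: "e * e = e" using e by (simp add: idempotents_def)
  have ee': "e * (e * x) = e * x" for x
    using ee by (simp add: mult.assoc[symmetric])
  have comm: "e * (s\<^sup>\<star> * (s * x)) = s\<^sup>\<star> * (s * (e * x))" for x
    using arg_cong[OF idempotent_commute[OF e source_idempotent[of s]], of "\<lambda>y. y * x"]
    by (simp only: mult.assoc)
  have s: "s * (s\<^sup>\<star> * (s * x)) = s * x" for x
    using arg_cong[OF star_mult_self[of s], of "\<lambda>y. y * x"] by (simp only: mult.assoc)
  have s': "s\<^sup>\<star> * (s * s\<^sup>\<star>) = s\<^sup>\<star>"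
    using self_mult_star[of s] by (simp only: mult.assoc)
  have "(s * e)\<^sup>\<star> = e * s\<^sup>\<star>"
  proof (rule star_unique)
    show "s * e * (e * s\<^sup>\<star>) * (s * e) = s * e"
      by (simp add: mult.assoc ee ee' comm s)
    have "e * s\<^sup>\<star> * (s * e) * (e * s\<^sup>\<star>) = e * (s\<^sup>\<star> * (s * (e * s\<^sup>\<star>)))"
      by (simp add: mult.assoc ee ee')
    also have "\<dots> = e * (e * (s\<^sup>\<star> * (s * s\<^sup>\<star>)))" by (simp add: comm)
    also have "\<dots> = e * s\<^sup>\<star>" by (simp add: ee' s')
    finally show "e * s\<^sup>\<star> * (s * e) * (e * s\<^sup>\<star>) = e * s\<^sup>\<star>" .
  qed
  then show ?thesis by (simp add: mult.assoc comm ee)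
qed

lemma natural_le_iff_source: "u \<preceq> s \<longleftrightarrow> s * (u\<^sup>\<star> * u) = u"
  by (simp add: natural_le_def mult.assoc)

lemma natural_le_idempotent_iff:
  assumes "e \<in> idempotents"
  shows "e \<preceq> f \<longleftrightarrow> f * e = e"
  using assms by (simp add: natural_le_iff_source star_idempotent) (simp add: idempotents_def)

lemma mult_idempotent_le:
  assumes "e \<in> idempotents"
  shows "s * e \<preceq> s"
  by (simp add: natural_le_iff_source source_mult_idempotent[OF assms])
    (simp add: mult.assoc[symmetric] star_mult_self)

lemma source_mono:
  assumes "u \<preceq> v"
  shows "(v\<^sup>\<star> * v) * (u\<^sup>\<star> * u) = u\<^sup>\<star> * u"
  using source_mult_idempotent[OF source_idempotent[of u], of v] assms
  by (simp add: natural_le_iff_source)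

text \<open>Elements below a common element are restrictions of it, so they are compared by their
  sources alone.\<close>

lemma natural_le_if_source_le:
  assumes u: "u \<preceq> s" and v: "v \<preceq> s" and le: "v\<^sup>\<star> * v \<preceq> u\<^sup>\<star> * u"
  shows "v \<preceq> u"
proof -
  have "u * (v\<^sup>\<star> * v) = s * ((u\<^sup>\<star> * u) * (v\<^sup>\<star> * v))"
    using u by (metis natural_le_iff_source mult.assoc)
  also have "\<dots> = v"
    using le v by (metis natural_le_idempotent_iff natural_le_iff_source source_idempotent)
  finally show ?thesis by (simp add: natural_le_iff_source)
qed


section \<open>When a groupoid of germs is Hausdorff\<close>

text \<open>The conditions below are all that the topology of the groupoid of germs uses of an
  action.\<close>

locale germ_data =
  fixes Z :: "'z topology" and \<theta> :: "'s::inverse_semigroup \<Rightarrow> 'z \<rightharpoonup> 'z"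
  assumes openin_act_dom: "e \<in> idempotents \<Longrightarrow> openin Z (act_dom \<theta> e)"
    and act_dom_mult: "e \<in> idempotents \<Longrightarrow> f \<in> idempotents \<Longrightarrow>
      act_dom \<theta> (e * f) = act_dom \<theta> e \<inter> act_dom \<theta> f"
begin

abbreviation source_dom :: "'s \<Rightarrow> 'z set"
  where "source_dom s \<equiv> act_dom \<theta> (s\<^sup>\<star> * s)"

text \<open>By \<open>germ_eq_iff\<close> below, this is the set of points at which \<open>s\<close> and \<open>t\<close> have the same germ.\<close>

definition agreement :: "'s \<Rightarrow> 's \<Rightarrow> 'z set"
  where "agreement s t = (\<Union>u\<in>down s \<inter> down t. source_dom u)"

lemma openin_source_dom: "openin Z (source_dom s)"
  by (rule openin_act_dom[OF source_idempotent])

lemma source_dom_mono: "u \<preceq> v \<Longrightarrow> source_dom u \<subseteq> source_dom v"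
  using act_dom_mult[OF source_idempotent source_idempotent] source_mono by (metis inf_le1)

lemma agreement_subset: "agreement s t \<subseteq> source_dom s \<inter> source_dom t"
  using source_dom_mono by (auto simp: agreement_def down_def)

lemma openin_agreement: "openin Z (agreement s t)"
  unfolding agreement_def using openin_source_dom by blast

lemma equiv_germ_rel: "equiv (germ_pairs \<theta>) (germ_rel \<theta>)"
proof (rule equivI)
  show "germ_rel \<theta> \<subseteq> germ_pairs \<theta> \<times> germ_pairs \<theta>"
    by (auto simp: germ_rel_def)
  show "refl_on (germ_pairs \<theta>) (germ_rel \<theta>)"
    using source_idempotent by (auto simp: refl_on_def germ_rel_def germ_pairs_def)
  show "sym (germ_rel \<theta>)"
    by (auto simp: sym_def germ_rel_def) metis
  show "trans (germ_rel \<theta>)"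
  proof (rule transI)
    fix p q r assume pq: "(p, q) \<in> germ_rel \<theta>" and qr: "(q, r) \<in> germ_rel \<theta>"
    obtain s t r' z where p: "p = (s, z)" "q = (t, z)" "r = (r', z)"
      using pq qr by (auto simp: germ_rel_def)
    obtain e where e: "e \<in> idempotents" "s * e = t * e" "z \<in> act_dom \<theta> e"
      using pq p by (auto simp: germ_rel_def)
    obtain f where f: "f \<in> idempotents" "t * f = r' * f" "z \<in> act_dom \<theta> f"
      using qr p by (auto simp: germ_rel_def)
    have "s * (e * f) = t * (f * e)"
      using e(2) by (simp add: idempotent_commute[OF f(1) e(1)] mult.assoc[symmetric])
    also have "\<dots> = r' * (f * e)"
      using f(2) by (simp add: mult.assoc[symmetric])
    also have "f * e = e * f" by (rule idempotent_commute[OF f(1) e(1)])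
    finally have "s * (e * f) = r' * (e * f)" .
    moreover have "z \<in> act_dom \<theta> (e * f)" using act_dom_mult e f by blast
    ultimately show "(p, r) \<in> germ_rel \<theta>"
      using pq qr p idempotent_mult[OF e(1) f(1)] by (auto simp: germ_rel_def)
  qed
qed

text \<open>If \<open>s * e = t * e\<close> then \<open>u = s * e\<close> lies below both \<open>s\<close> and \<open>t\<close>; conversely a common lower
  bound \<open>u\<close> witnesses equality of germs through its source \<open>e = u\<^sup>\<star> * u\<close>.\<close>

lemma germ_eq_iff:
  assumes s: "z \<in> source_dom s" and t: "w \<in> source_dom t"
  shows "germ \<theta> s z = germ \<theta> t w \<longleftrightarrow> z = w \<and> z \<in> agreement s t"
proof -
  have pairs: "(s, z) \<in> germ_pairs \<theta>" "(t, w) \<in> germ_pairs \<theta>"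
    using s t by (auto simp: germ_pairs_def)
  have "germ \<theta> s z = germ \<theta> t w \<longleftrightarrow> ((s, z), (t, w)) \<in> germ_rel \<theta>"
    unfolding germ_def by (rule eq_equiv_class_iff[OF equiv_germ_rel pairs])
  also have "\<dots> \<longleftrightarrow> z = w \<and> (\<exists>e\<in>idempotents. s * e = t * e \<and> z \<in> act_dom \<theta> e)"
    using pairs by (auto simp: germ_rel_def)
  also have "\<dots> \<longleftrightarrow> z = w \<and> z \<in> agreement s t"
  proof (intro conj_cong refl iffI)
    assume "\<exists>e\<in>idempotents. s * e = t * e \<and> z \<in> act_dom \<theta> e"
    then obtain e where e: "e \<in> idempotents" "s * e = t * e" "z \<in> act_dom \<theta> e" by blast
    have "source_dom (s * e) = source_dom s \<inter> act_dom \<theta> e"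
      using act_dom_mult[OF source_idempotent e(1)] by (simp add: source_mult_idempotent[OF e(1)])
    then have "z \<in> source_dom (s * e)" using s e by blast
    moreover have "s * e \<preceq> s" "s * e \<preceq> t"
      using mult_idempotent_le[OF e(1)] e(2) by metis+
    ultimately show "z \<in> agreement s t"
      by (auto simp: agreement_def down_def)
  next
    assume "z \<in> agreement s t"
    then obtain u where u: "u \<preceq> s" "u \<preceq> t" "z \<in> source_dom u"
      by (auto simp: agreement_def down_def)
    then have "s * (u\<^sup>\<star> * u) = t * (u\<^sup>\<star> * u)" by (simp add: natural_le_iff_source)
    with u(3) show "\<exists>e\<in>idempotents. s * e = t * e \<and> z \<in> act_dom \<theta> e"
      using source_idempotent[of u] by blast
  qed
  finally show ?thesis .
qed

lemma openin_germ_image: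
  assumes "openin Z U" "U \<subseteq> source_dom s"
  shows "openin (germ_topology Z \<theta>) (germ \<theta> s ` U)"
  unfolding germ_topology_def using assms by (intro topology_generated_by_Basis) blast

lemma topspace_germ_topology:
  "topspace (germ_topology Z \<theta>) = (\<Union>s. germ \<theta> s ` source_dom s)"
  unfolding germ_topology_def topology_generated_by_topspace using openin_source_dom by auto

lemma continuous_map_germ:
  "continuous_map (subtopology Z (source_dom s)) (germ_topology Z \<theta>) (germ \<theta> s)"
  unfolding germ_topology_def
proof (rule continuous_on_generated_topo)
  have top: "topspace (subtopology Z (source_dom s)) = source_dom s"
    using openin_subset[OF openin_source_dom] by auto
  show "germ \<theta> s ` topspace (subtopology Z (source_dom s)) \<subseteq>
      \<Union> {germ \<theta> s ` U |s U. openin Z U \<and> U \<subseteq> act_dom \<theta> (s\<^sup>\<star> * s)}"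
    unfolding top using openin_source_dom[of s] by blast
  fix W assume "W \<in> {germ \<theta> s ` U |s U. openin Z U \<and> U \<subseteq> act_dom \<theta> (s\<^sup>\<star> * s)}"
  then obtain t U where W: "W = germ \<theta> t ` U" and U: "openin Z U" "U \<subseteq> source_dom t" by blast
  have "germ \<theta> s z \<in> W \<longleftrightarrow> z \<in> U \<inter> agreement s t" if "z \<in> source_dom s" for z
    using germ_eq_iff[OF that] U(2) unfolding W by blast
  then have "germ \<theta> s -` W \<inter> source_dom s = U \<inter> agreement s t"
    using agreement_subset by blast
  moreover have "openin (subtopology Z (source_dom s)) (U \<inter> agreement s t)"
    using openin_Int[OF U(1) openin_agreement] agreement_subset openin_source_dom
    by (metis openin_open_subtopology inf.coboundedI2 le_inf_iff)
  ultimately show "openin (subtopology Z (source_dom s))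
      (germ \<theta> s -` W \<inter> topspace (subtopology Z (source_dom s)))"
    unfolding top by simp
qed

text \<open>On \<open>source_dom s \<inter> source_dom t\<close> the set \<open>agreement s t\<close> is the equalizer of the two continuous
  sections \<open>z \<mapsto> [s, z]\<close> and \<open>z \<mapsto> [t, z]\<close>, hence closed if the groupoid is Hausdorff. Conversely, off a
  closed \<open>agreement s t\<close> these two sections have disjoint images.\<close>

theorem Hausdorff_germ_topology_iff:
  assumes Z: "Hausdorff_space Z"
  shows "Hausdorff_space (germ_topology Z \<theta>) \<longleftrightarrow>
    (\<forall>s t. closedin (subtopology Z (source_dom s \<inter> source_dom t)) (agreement s t))"
proof (intro iffI allI)
  fix s t assume H: "Hausdorff_space (germ_topology Z \<theta>)"
  let ?D = "source_dom s \<inter> source_dom t"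
  let ?ZD = "subtopology Z ?D"
  have top: "topspace ?ZD = ?D" using openin_subset[OF openin_source_dom[of s]] by auto
  have "continuous_map ?ZD (germ_topology Z \<theta>) (germ \<theta> s)"
    "continuous_map ?ZD (germ_topology Z \<theta>) (germ \<theta> t)"
    using continuous_map_from_subtopology_mono[OF continuous_map_germ] by (meson inf_le1 inf_le2)+
  from closedin_continuous_maps_eq[OF H this]
  have "closedin ?ZD {z \<in> ?D. germ \<theta> s z = germ \<theta> t z}" unfolding top .
  moreover have "{z \<in> ?D. germ \<theta> s z = germ \<theta> t z} = agreement s t"
    using germ_eq_iff agreement_subset by blast
  ultimately show "closedin ?ZD (agreement s t)" by simp
next
  assume closed: "\<forall>s t. closedin (subtopology Z (source_dom s \<inter> source_dom t)) (agreement s t)"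
  show "Hausdorff_space (germ_topology Z \<theta>)"
    unfolding Hausdorff_space_def
  proof (intro allI impI)
    fix g h
    assume gh: "g \<in> topspace (germ_topology Z \<theta>) \<and> h \<in> topspace (germ_topology Z \<theta>) \<and> g \<noteq> h"
    then obtain s z t w where g: "g = germ \<theta> s z" "z \<in> source_dom s"
      and h: "h = germ \<theta> t w" "w \<in> source_dom t"
      by (auto simp: topspace_germ_topology)
    have tops: "z \<in> topspace Z" "w \<in> topspace Z"
      using g h openin_subset[OF openin_source_dom] by blast+
    \<comment> \<open>Basic neighbourhoods of the two germs are disjoint once their base sets never agree.\<close>
    have separate: "\<exists>U V. openin (germ_topology Z \<theta>) U \<and> openin (germ_topology Z \<theta>) V \<and>
        g \<in> U \<and> h \<in> V \<and> disjnt U V"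
      if "openin Z U" "U \<subseteq> source_dom s" "z \<in> U" "openin Z V" "V \<subseteq> source_dom t" "w \<in> V"
        "U \<inter> V \<inter> agreement s t = {}" for U V
    proof (intro exI conjI)
      show "disjnt (germ \<theta> s ` U) (germ \<theta> t ` V)"
        unfolding disjnt_iff using germ_eq_iff that by blast
    qed (use that openin_germ_image g h in auto)
    show "\<exists>U V. openin (germ_topology Z \<theta>) U \<and> openin (germ_topology Z \<theta>) V \<and>
        g \<in> U \<and> h \<in> V \<and> disjnt U V"
    proof (cases "z = w")
      case False
      then obtain U V where UV: "openin Z U" "openin Z V" "z \<in> U" "w \<in> V" "disjnt U V"
        using Z tops unfolding Hausdorff_space_def by meson
      show ?thesis
        by (rule separate[of "U \<inter> source_dom s" "V \<inter> source_dom t"])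
          (use UV g h openin_source_dom in \<open>auto simp: disjnt_iff\<close>)
    next
      case True
      let ?D = "source_dom s \<inter> source_dom t"
      have "openin (subtopology Z ?D) (topspace (subtopology Z ?D) - agreement s t)"
        using closed by blast
      then have "openin Z (topspace (subtopology Z ?D) - agreement s t)"
        by (rule openin_trans_full) (use openin_source_dom in blast)
      moreover have "topspace (subtopology Z ?D) = ?D"
        using openin_subset[OF openin_source_dom[of s]] by auto
      ultimately have op: "openin Z (?D - agreement s t)" by simp
      have "z \<notin> agreement s t" using gh g h True germ_eq_iff by blast
      then show ?thesis
        by (intro separate[of "?D - agreement s t" "?D - agreement s t"])
          (use op g h True in auto)
    qed
  qed
qed

end


section \<open>The space of filters for an action with compact domains\<close>

text \<open>A compact space has all of its closed sets compact, so that its one-point compactification is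
  just its disjoint union with a point.\<close>

lemma openin_Alexandroff_compactification_compact:
  assumes "compact_space Y"
  shows "openin (Alexandroff_compactification Y) V \<longleftrightarrow>
    V \<subseteq> insert None (Some ` topspace Y) \<and> openin Y {x. Some x \<in> V}" (is "?L \<longleftrightarrow> ?R")
proof
  assume L: ?L
  then consider U where "openin Y U" "V = Some ` U"
    | C where "closedin Y C" "V = insert None (Some ` (topspace Y - C))"
    unfolding openin_Alexandroff_compactification by blast
  then have "openin Y {x. Some x \<in> V}"
  proof cases
    case 1
    then have "{x. Some x \<in> V} = U" by blast
    with 1 show ?thesis by simp
  next
    case 2
    then have "{x. Some x \<in> V} = topspace Y - C" by blast
    with 2 show ?thesis by (simp add: openin_diff)
  qed
  with openin_subset[OF L] show ?R by simp
next
  assume R: ?R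
  let ?U = "{x. Some x \<in> V}"
  show ?L
  proof (cases "None \<in> V")
    case False
    then have "V = Some ` ?U" by (auto simp: image_iff) (metis not_None_eq)
    with R show ?L unfolding openin_Alexandroff_compactification by blast
  next
    case True
    have sub: "?U \<subseteq> topspace Y" using R openin_subset by blast
    have cl: "closedin Y (topspace Y - ?U)" using R by blast
    have "V = insert None (Some ` ?U)" using True by (auto simp: image_iff) (metis not_None_eq)
    also have "?U = topspace Y - (topspace Y - ?U)" using sub by blast
    finally have "V = insert None (Some ` (topspace Y - (topspace Y - ?U)))" .
    then show ?L
      unfolding openin_Alexandroff_compactification
      using cl closedin_compact_space[OF assms cl] by blast
  qed
qed

lemma KS_tildeI:
  assumes "\<tau> \<in> topspace (KS_product X \<theta>)"
    and "\<And>e f. e \<in> idempotents \<Longrightarrow> f \<in> idempotents \<Longrightarrow> e \<preceq> f \<Longrightarrow> \<tau> e \<noteq> None \<Longrightarrow> \<tau> f = \<tau> e"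
    and "\<And>e f. e \<in> idempotents \<Longrightarrow> f \<in> idempotents \<Longrightarrow> \<tau> e \<noteq> None \<Longrightarrow> \<tau> f \<noteq> None \<Longrightarrow>
      \<tau> (e * f) \<noteq> None"
  shows "\<tau> \<in> KS_tilde X \<theta>"
  unfolding KS_tilde_def mem_Collect_eq
proof (intro conjI ballI impI)
  show "\<tau> \<in> topspace (KS_product X \<theta>)" by (rule assms(1))
next
  fix e f assume "e \<in> idempotents" "f \<in> idempotents" "e \<preceq> f \<and> \<tau> e \<noteq> None"
  then show "\<tau> f = \<tau> e" by (elim conjE) (rule assms(2))
next
  fix e f assume "e \<in> idempotents" "f \<in> idempotents" "\<tau> e \<noteq> None \<and> \<tau> f \<noteq> None"
  then show "\<tau> (e * f) \<noteq> None" by (elim conjE) (rule assms(3))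
qed

lemma KS_tilde_up:
  "\<tau> \<in> KS_tilde X \<theta> \<Longrightarrow> e \<in> idempotents \<Longrightarrow> f \<in> idempotents \<Longrightarrow> e \<preceq> f \<Longrightarrow> \<tau> e \<noteq> None \<Longrightarrow>
    \<tau> f = \<tau> e"
  unfolding KS_tilde_def by blast

lemma KS_tilde_mult:
  "\<tau> \<in> KS_tilde X \<theta> \<Longrightarrow> e \<in> idempotents \<Longrightarrow> f \<in> idempotents \<Longrightarrow> \<tau> e \<noteq> None \<Longrightarrow> \<tau> f \<noteq> None \<Longrightarrow>
    \<tau> (e * f) \<noteq> None"
  unfolding KS_tilde_def by blast

locale compact_action =
  fixes X :: "'x topology" and \<theta> :: "'s::inverse_semigroup \<Rightarrow> 'x \<rightharpoonup> 'x"
  assumes locally_compact: "locally_compact_space X" and Hausdorff: "Hausdorff_space X"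
    and action: "semigroup_action X \<theta>"
    and compact_dom: "e \<in> idempotents \<Longrightarrow> compactin X (act_dom \<theta> e)"
begin

abbreviation KS_dom :: "'s \<Rightarrow> ('s \<Rightarrow> 'x option) set"
  where "KS_dom e \<equiv> act_dom (KS_action X \<theta>) e"

lemma openin_act_dom_X: "e \<in> idempotents \<Longrightarrow> openin X (act_dom \<theta> e)"
  using action by (simp add: semigroup_action_def)

lemma act_dom_subset_topspace: "e \<in> idempotents \<Longrightarrow> act_dom \<theta> e \<subseteq> topspace X"
  using openin_act_dom_X openin_subset by blast

lemma act_dom_mono:
  assumes "e \<in> idempotents" "e \<preceq> f"
  shows "act_dom \<theta> e \<subseteq> act_dom \<theta> f"
proof
  fix x assume x: "x \<in> act_dom \<theta> e"
  have fe: "f * e = e" using natural_le_idempotent_iff[OF assms(1)] assms(2) by simp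
  have "\<theta> (f * e) = \<theta> f \<circ>\<^sub>m \<theta> e"
    using action unfolding semigroup_action_def by blast
  then have "(\<theta> f \<circ>\<^sub>m \<theta> e) x = \<theta> e x" unfolding fe by (rule fun_cong[OF sym])
  moreover have "\<theta> e x = Some x" using x by (simp add: act_dom_def)
  ultimately show "x \<in> act_dom \<theta> f" by (simp add: act_dom_def)
qed

lemma compact_space_KS_product: "compact_space (KS_product X \<theta>)"
  by (simp add: KS_product_def compact_space_product_topology)

text \<open>Both topologies on the values have the same open sets within \<open>X\<^sub>e\<close>, and \<open>None\<close> is isolated in the
  smaller compactification; so all coordinates may be compared inside one Hausdorff space.\<close>

lemma continuous_map_coordinate:
  assumes e: "e \<in> idempotents"
  shows "continuous_map (KS_product X \<theta>) (Alexandroff_compactification X) (\<lambda>\<tau>. \<tau> e)"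
proof -
  let ?Y = "subtopology X (act_dom \<theta> e)"
  have cY: "compact_space ?Y" using compact_dom[OF e] by (simp add: compact_space_subtopology)
  have top: "topspace ?Y = act_dom \<theta> e" using act_dom_subset_topspace[OF e] by auto
  have "continuous_map (Alexandroff_compactification ?Y) (Alexandroff_compactification X) id"
    unfolding continuous_map_def
  proof (intro conjI allI impI)
    show "id \<in> topspace (Alexandroff_compactification ?Y) \<rightarrow>
        topspace (Alexandroff_compactification X)"
      by auto
    fix U assume U: "openin (Alexandroff_compactification X) U"
    have "openin X {x. Some x \<in> U}"
    proof -
      from U consider V where "openin X V" "U = Some ` V"
        | C where "closedin X C" "U = insert None (Some ` (topspace X - C))"
        unfolding openin_Alexandroff_compactification by blast
      then show ?thesis
      proof cases
        case 1
        then have "{x. Some x \<in> U} = V" by blast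
        with 1 show ?thesis by simp
      next
        case 2
        then have "{x. Some x \<in> U} = topspace X - C" by blast
        with 2 show ?thesis by (simp add: openin_diff)
      qed
    qed
    then have "openin ?Y ({x. Some x \<in> U} \<inter> act_dom \<theta> e)"
      by (rule openin_subtopology_Int)
    moreover have "{x. Some x \<in> {v \<in> topspace (Alexandroff_compactification ?Y). id v \<in> U}}
        = {x. Some x \<in> U} \<inter> act_dom \<theta> e"
      using top by auto
    ultimately show "openin (Alexandroff_compactification ?Y)
        {v \<in> topspace (Alexandroff_compactification ?Y). id v \<in> U}"
      unfolding openin_Alexandroff_compactification_compact[OF cY] by auto
  qed
  moreover have "continuous_map (KS_product X \<theta>) (Alexandroff_compactification ?Y) (\<lambda>\<tau>. \<tau> e)"
    unfolding KS_product_def using continuous_map_product_projection[OF e] by fast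
  ultimately show ?thesis using continuous_map_compose by (metis id_comp)
qed

lemma clopen_coordinate_None:
  assumes e: "e \<in> idempotents"
  shows "openin (KS_product X \<theta>) {\<tau> \<in> topspace (KS_product X \<theta>). \<tau> e = None}"
    and "closedin (KS_product X \<theta>) {\<tau> \<in> topspace (KS_product X \<theta>). \<tau> e = None}"
proof -
  let ?Y = "subtopology X (act_dom \<theta> e)"
  have cY: "compact_space ?Y" using compact_dom[OF e] by (simp add: compact_space_subtopology)
  have "openin (Alexandroff_compactification ?Y) {None}"
    "openin (Alexandroff_compactification ?Y) (topspace (Alexandroff_compactification ?Y) - {None})"
    unfolding topspace_Alexandroff_compactification_delete
    by (simp_all add: openin_Alexandroff_compactification_compact[OF cY]
        flip: topspace_subtopology)
  then have op: "openin (Alexandroff_compactification ?Y) {None}"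
    and cl: "closedin (Alexandroff_compactification ?Y) {None}"
    by (simp_all add: closedin_def)
  have cont: "continuous_map (KS_product X \<theta>) (Alexandroff_compactification ?Y) (\<lambda>\<tau>. \<tau> e)"
    unfolding KS_product_def using continuous_map_product_projection[OF e] by fast
  show "openin (KS_product X \<theta>) {\<tau> \<in> topspace (KS_product X \<theta>). \<tau> e = None}"
    using openin_continuous_map_preimage[OF cont op] by simp
  show "closedin (KS_product X \<theta>) {\<tau> \<in> topspace (KS_product X \<theta>). \<tau> e = None}"
    using closedin_continuous_map_preimage[OF cont cl] by simp
qed

lemma clopen_coordinate_Some:
  assumes e: "e \<in> idempotents"
  shows "openin (KS_product X \<theta>) {\<tau> \<in> topspace (KS_product X \<theta>). \<tau> e \<noteq> None}"
    and "closedin (KS_product X \<theta>) {\<tau> \<in> topspace (KS_product X \<theta>). \<tau> e \<noteq> None}"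
proof -
  let ?P = "KS_product X \<theta>"
  have eq: "{\<tau> \<in> topspace ?P. \<tau> e \<noteq> None} = topspace ?P - {\<tau> \<in> topspace ?P. \<tau> e = None}"
    by auto
  show "openin ?P {\<tau> \<in> topspace ?P. \<tau> e \<noteq> None}" "closedin ?P {\<tau> \<in> topspace ?P. \<tau> e \<noteq> None}"
    unfolding eq using clopen_coordinate_None[OF e] by blast+
qed

text \<open>Filters are closed: each instance of the two defining conditions involves only coordinates in
  finitely many idempotents, and cuts out a closed set because \<open>\<tau> e = None\<close> is a clopen
  condition and \<open>\<tau> f = \<tau> e\<close> is an equality of continuous maps into a Hausdorff space.\<close>

lemma closedin_KS_tilde: "closedin (KS_product X \<theta>) (KS_tilde X \<theta>)"
proof -
  let ?P = "KS_product X \<theta>"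
  let ?N = "\<lambda>e. {\<tau> \<in> topspace ?P. \<tau> e = None}"
  have HX: "Hausdorff_space (Alexandroff_compactification X)"
    by (simp add: Hausdorff_space_Alexandroff_compactification Hausdorff locally_compact)
  define up where "up e f = ?N e \<union> {\<tau> \<in> topspace ?P. \<tau> f = \<tau> e}" for e f
  define meet where
    "meet e f = ?N e \<union> ?N f \<union> {\<tau> \<in> topspace ?P. \<tau> (e * f) \<noteq> None}" for e f
  have up: "closedin ?P (up e f)" if "e \<in> idempotents" "f \<in> idempotents" for e f
    unfolding up_def
    using clopen_coordinate_None(2) that
      closedin_continuous_maps_eq[OF HX continuous_map_coordinate continuous_map_coordinate]
    by (intro closedin_Un) auto
  have meet: "closedin ?P (meet e f)" if "e \<in> idempotents" "f \<in> idempotents" for e f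
    unfolding meet_def using clopen_coordinate_None(2) clopen_coordinate_Some(2) that
    by (intro closedin_Un) (auto simp: idempotent_mult)
  define \<C> where "\<C> = insert (topspace ?P)
    ({up e f | e f. e \<in> idempotents \<and> f \<in> idempotents \<and> e \<preceq> f} \<union>
     {meet e f | e f. e \<in> idempotents \<and> f \<in> idempotents})"
  have "closedin ?P (\<Inter>\<C>)"
    using up meet by (intro closedin_Inter) (auto simp: \<C>_def)
  moreover have "KS_tilde X \<theta> = \<Inter>\<C>"
  proof
    show "KS_tilde X \<theta> \<subseteq> \<Inter>\<C>"
    proof
      fix \<tau> assume \<tau>: "\<tau> \<in> KS_tilde X \<theta>"
      have "\<tau> \<in> up e f" if "e \<in> idempotents" "f \<in> idempotents" "e \<preceq> f" for e f
        using \<tau> that unfolding KS_tilde_def up_def by blast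
      moreover have "\<tau> \<in> meet e f" if "e \<in> idempotents" "f \<in> idempotents" for e f
        using \<tau> that unfolding KS_tilde_def meet_def by blast
      moreover have "\<tau> \<in> topspace ?P" using \<tau> unfolding KS_tilde_def by blast
      ultimately show "\<tau> \<in> \<Inter>\<C>" unfolding \<C>_def by blast
    qed
    show "\<Inter>\<C> \<subseteq> KS_tilde X \<theta>"
    proof
      fix \<tau> assume \<tau>: "\<tau> \<in> \<Inter>\<C>"
      show "\<tau> \<in> KS_tilde X \<theta>"
      proof (rule KS_tildeI)
        show "\<tau> \<in> topspace ?P" using \<tau> by (simp add: \<C>_def)
      next
        fix e f assume ef: "e \<in> idempotents" "f \<in> idempotents" "e \<preceq> f" and ne: "\<tau> e \<noteq> None"
        have "up e f \<in> \<C>" using ef unfolding \<C>_def by blast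
        with \<tau> have "\<tau> \<in> up e f" by (rule InterD)
        with ne show "\<tau> f = \<tau> e" by (auto simp: up_def)
      next
        fix e f assume ef: "e \<in> idempotents" "f \<in> idempotents" and ne: "\<tau> e \<noteq> None" "\<tau> f \<noteq> None"
        have "meet e f \<in> \<C>" using ef unfolding \<C>_def by blast
        with \<tau> have "\<tau> \<in> meet e f" by (rule InterD)
        with ne show "\<tau> (e * f) \<noteq> None" by (auto simp: meet_def)
      qed
    qed
  qed
  ultimately show ?thesis by simp
qed

lemma topspace_KS_space: "topspace (KS_space X \<theta>) = KS_tilde X \<theta> - {KS_infinity}"
  unfolding KS_space_def topspace_subtopology
  using closedin_subset[OF closedin_KS_tilde] by (metis Diff_subset inf.absorb2 order_trans)

lemma Hausdorff_KS_space: "Hausdorff_space (KS_space X \<theta>)"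
  unfolding KS_space_def KS_product_def
proof (intro Hausdorff_space_subtopology)
  have "Hausdorff_space (Alexandroff_compactification (subtopology X (act_dom \<theta> e)))"
    if "e \<in> idempotents" for e
    using compact_dom[OF that] Hausdorff
    by (simp add: Hausdorff_space_Alexandroff_compactification Hausdorff_space_subtopology
        compact_imp_locally_compact_space compact_space_subtopology)
  then show "Hausdorff_space (product_topology
      (\<lambda>e. Alexandroff_compactification (subtopology X (act_dom \<theta> e))) idempotents)"
    by (simp add: Hausdorff_space_product_topology)
qed

lemma KS_dom_eq:
  assumes "e \<in> idempotents"
  shows "KS_dom e = {\<tau> \<in> KS_tilde X \<theta>. \<tau> e \<noteq> None}"
proof -
  have "\<tau> \<noteq> KS_infinity" if "\<tau> e \<noteq> None" for \<tau> :: "'s \<Rightarrow> 'x option"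
    using assms that by (metis KS_infinity_def restrict_apply')
  then have "\<tau> \<in> KS_tilde X \<theta> - {KS_infinity} \<and> \<tau> e \<noteq> None \<longleftrightarrow>
      \<tau> \<in> KS_tilde X \<theta> \<and> \<tau> e \<noteq> None" for \<tau>
    by blast
  then show ?thesis
    unfolding act_dom_KS_action[OF assms] topspace_KS_space by (rule Collect_cong)
qed

lemma KS_dom_eq_preimage:
  assumes "e \<in> idempotents"
  shows "KS_dom e = {\<tau> \<in> topspace (KS_product X \<theta>). \<tau> e \<noteq> None} \<inter>
    (KS_tilde X \<theta> - {KS_infinity})"
  unfolding act_dom_KS_action[OF assms] KS_space_def topspace_subtopology
  by (rule set_eqI) (simp only: mem_Collect_eq Int_iff conj_ac)

lemma openin_KS_dom: "e \<in> idempotents \<Longrightarrow> openin (KS_space X \<theta>) (KS_dom e)"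
  unfolding KS_space_def KS_dom_eq_preimage
  by (intro openin_subtopology_Int clopen_coordinate_Some)

lemma closedin_KS_dom: "e \<in> idempotents \<Longrightarrow> closedin (KS_space X \<theta>) (KS_dom e)"
  unfolding KS_space_def closedin_subtopology
  using clopen_coordinate_Some(2) KS_dom_eq_preimage by (intro exI conjI)

text \<open>Removing \<open>\<infinity>\<close> from the compact space of all \<open>\<tau>\<close> does not affect \<open>Z\<^sub>e\<close>, which is clopen in it
  and does not contain \<open>\<infinity>\<close>.\<close>

lemma compactin_KS_dom:
  assumes e: "e \<in> idempotents"
  shows "compactin (KS_space X \<theta>) (KS_dom e)"
proof -
  have restrict: "{x \<in> A. Q x} = {x \<in> B. Q x} \<inter> A" if "A \<subseteq> B" for A B :: "'b set" and Q
    using that by blast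
  have "KS_dom e = {\<tau> \<in> topspace (KS_product X \<theta>). \<tau> e \<noteq> None} \<inter> KS_tilde X \<theta>"
    unfolding KS_dom_eq[OF e] by (rule restrict[OF closedin_subset[OF closedin_KS_tilde]])
  then have "closedin (KS_product X \<theta>) (KS_dom e)"
    using closedin_Int[OF clopen_coordinate_Some(2)[OF e] closedin_KS_tilde] by (rule ssubst)
  then have "compactin (KS_product X \<theta>) (KS_dom e)"
    by (rule closedin_compact_space[OF compact_space_KS_product])
  moreover have "KS_dom e \<subseteq> KS_tilde X \<theta> - {KS_infinity}"
    unfolding KS_dom_eq_preimage[OF e] by (rule Int_lower2)
  ultimately show ?thesis
    unfolding KS_space_def compactin_subtopology by (rule conjI)
qed

lemma KS_dom_mult:
  assumes e: "e \<in> idempotents" and f: "f \<in> idempotents"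
  shows "KS_dom (e * f) = KS_dom e \<inter> KS_dom f"
proof -
  have ef: "e * f \<in> idempotents" by (rule idempotent_mult[OF e f])
  have le: "e * f \<preceq> e" "e * f \<preceq> f"
    using mult_idempotent_le[OF f, of e] mult_idempotent_le[OF e, of f]
      idempotent_commute[OF e f] by simp_all
  show ?thesis
  proof (intro equalityI subsetI IntI)
    fix \<tau> assume "\<tau> \<in> KS_dom (e * f)"
    then have \<tau>: "\<tau> \<in> KS_tilde X \<theta>" "\<tau> (e * f) \<noteq> None" by (auto simp: KS_dom_eq[OF ef])
    show "\<tau> \<in> KS_dom e" "\<tau> \<in> KS_dom f"
      using \<tau> KS_tilde_up[OF \<tau>(1) ef e le(1) \<tau>(2)] KS_tilde_up[OF \<tau>(1) ef f le(2) \<tau>(2)]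
      by (simp_all add: KS_dom_eq e f del: not_None_eq)
  next
    fix \<tau> assume "\<tau> \<in> KS_dom e \<inter> KS_dom f"
    then show "\<tau> \<in> KS_dom (e * f)"
      unfolding KS_dom_eq[OF e] KS_dom_eq[OF f] KS_dom_eq[OF ef] using KS_tilde_mult[OF _ e f] by blast
  qed
qed

sublocale KS: germ_data "KS_space X \<theta>" "KS_action X \<theta>"
  by unfold_locales (simp_all add: openin_KS_dom KS_dom_mult)

text \<open>The witness is the principal filter of \<open>e\<close> together with the point \<open>x\<close>.\<close>

lemma principal_point:
  assumes e: "e \<in> idempotents" and x: "x \<in> act_dom \<theta> e"
  obtains \<tau> where "\<tau> \<in> KS_dom e" "\<forall>f\<in>idempotents. \<tau> \<in> KS_dom f \<longrightarrow> e \<preceq> f"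
proof
  define \<tau> where "\<tau> = (\<lambda>f\<in>idempotents. if e \<preceq> f then Some x else None)"
  have le: "e \<preceq> f \<longleftrightarrow> f * e = e" for f by (rule natural_le_idempotent_iff[OF e])
  have \<tau>: "\<tau> f = (if f * e = e then Some x else None)" if "f \<in> idempotents" for f
    using that by (simp add: \<tau>_def le)
  have \<tau>_iff: "\<tau> f \<noteq> None \<longleftrightarrow> f * e = e" if "f \<in> idempotents" for f
    using \<tau>[OF that] by simp
  have "\<tau> \<in> topspace (KS_product X \<theta>)"
  proof -
    have "x \<in> topspace X \<inter> act_dom \<theta> f" if "e \<preceq> f" for f
      using act_dom_mono[OF e that] act_dom_subset_topspace[OF e] x by blast
    then show ?thesis by (auto simp: \<tau>_def KS_product_def)
  qed
  moreover have "\<tau> g = \<tau> f"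
    if "f \<in> idempotents" "g \<in> idempotents" "f \<preceq> g" "\<tau> f \<noteq> None" for f g
  proof -
    have ef: "f * e = e" using \<tau>_iff[OF that(1)] that(4) by (rule iffD1)
    have "g * f = f" using that(3) natural_le_idempotent_iff[OF that(1)] by simp
    then have "g * (f * e) = f * e" by (simp add: mult.assoc[symmetric])
    then have "g * e = e" using ef by simp
    then show ?thesis using ef \<tau>[OF that(1)] \<tau>[OF that(2)] by simp
  qed
  moreover have "\<tau> (f * g) \<noteq> None"
    if "f \<in> idempotents" "g \<in> idempotents" "\<tau> f \<noteq> None" "\<tau> g \<noteq> None" for f g
  proof -
    have "f * e = e" using \<tau>_iff[OF that(1)] that(3) by (rule iffD1)
    moreover have "g * e = e" using \<tau>_iff[OF that(2)] that(4) by (rule iffD1)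
    ultimately have "f * g * e = e" by (simp add: mult.assoc)
    with \<tau>_iff[OF idempotent_mult[OF that(1,2)]] show ?thesis by (rule iffD2)
  qed
  ultimately have tilde: "\<tau> \<in> KS_tilde X \<theta>" by (rule KS_tildeI)
  have "e * e = e" using e by (simp add: idempotents_def)
  then show "\<tau> \<in> KS_dom e" using tilde \<tau>[OF e] by (simp add: KS_dom_eq[OF e])
  show "\<forall>f\<in>idempotents. \<tau> \<in> KS_dom f \<longrightarrow> e \<preceq> f"
  proof (intro ballI impI)
    fix f assume f: "f \<in> idempotents" and dom: "\<tau> \<in> KS_dom f"
    have "\<tau> f \<noteq> None" using dom unfolding KS_dom_eq[OF f] by simp
    then show "e \<preceq> f" unfolding le \<tau>_iff[OF f] .
  qed
qed

lemma KS_dom_eq_empty_iff: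
  assumes e: "e \<in> idempotents"
  shows "KS_dom e = {} \<longleftrightarrow> act_dom \<theta> e = {}"
proof
  assume emp: "KS_dom e = {}"
  show "act_dom \<theta> e = {}"
  proof (rule equals0I)
    fix x assume "x \<in> act_dom \<theta> e"
    then obtain \<tau> where "\<tau> \<in> KS_dom e" by (rule principal_point[OF e])
    with emp show False by simp
  qed
next
  assume emp: "act_dom \<theta> e = {}"
  have "\<tau> e = None" if "\<tau> \<in> KS_tilde X \<theta>" for \<tau>
  proof -
    have "\<tau> \<in> topspace (KS_product X \<theta>)"
      by (rule subsetD[OF closedin_subset[OF closedin_KS_tilde] that])
    then have "\<tau> e \<in> topspace (Alexandroff_compactification (subtopology X (act_dom \<theta> e)))"
      using e by (auto simp: KS_product_def)
    then show ?thesis using emp by simp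
  qed
  then show "KS_dom e = {}" by (auto simp: KS_dom_eq[OF e])
qed


section \<open>Finite covers and the weak semilattice condition\<close>

abbreviation nonempty_elements :: "'s set"
  where "nonempty_elements \<equiv> {s. act_dom \<theta> (s\<^sup>\<star> * s) \<noteq> {}}"

text \<open>Restricting to lower bounds in \<open>S\<^sup>X\<close> loses nothing, because \<open>Z\<^bsub>u\<^sup>\<star>u\<^esub>\<close> is empty for all others.\<close>

lemma KS_agreement_eq:
  "KS.agreement s t = (\<Union>u\<in>nonempty_elements \<inter> down s \<inter> down t. KS.source_dom u)"
proof -
  have ne: "act_dom \<theta> (u\<^sup>\<star> * u) \<noteq> {}" if "\<tau> \<in> KS.source_dom u" for u \<tau>
    using KS_dom_eq_empty_iff[OF source_idempotent[of u]] that by (metis empty_iff)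
  show ?thesis
  proof (rule set_eqI)
    fix \<tau>
    show "\<tau> \<in> KS.agreement s t \<longleftrightarrow>
        \<tau> \<in> (\<Union>u\<in>nonempty_elements \<inter> down s \<inter> down t. KS.source_dom u)"
      unfolding KS.agreement_def UN_iff Bex_def Int_iff mem_Collect_eq
    proof (rule ex_cong1)
      fix u
      show "(u \<in> down s \<and> u \<in> down t) \<and> \<tau> \<in> KS.source_dom u \<longleftrightarrow>
          ((act_dom \<theta> (u\<^sup>\<star> * u) \<noteq> {} \<and> u \<in> down s) \<and> u \<in> down t) \<and> \<tau> \<in> KS.source_dom u"
        using ne[of \<tau> u] by argo
    qed
  qed
qed

lemma closedin_agreement_if_finite_cover:
  assumes F: "finite F" "F \<subseteq> nonempty_elements \<inter> down s \<inter> down t"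
    and cover: "nonempty_elements \<inter> down s \<inter> down t \<subseteq> (\<Union>u\<in>F. down u)"
  shows "closedin (KS_space X \<theta>) (KS.agreement s t)"
proof -
  have "KS.agreement s t = (\<Union>u\<in>F. KS.source_dom u)"
    unfolding KS_agreement_eq
  proof (rule equalityI)
    show "(\<Union>u\<in>nonempty_elements \<inter> down s \<inter> down t. KS.source_dom u)
        \<subseteq> (\<Union>u\<in>F. KS.source_dom u)"
    proof (rule UN_least)
      fix u assume "u \<in> nonempty_elements \<inter> down s \<inter> down t"
      with cover have "u \<in> (\<Union>v\<in>F. down v)" by (rule subsetD)
      then obtain v where v: "v \<in> F" "u \<in> down v" by (rule UN_E)
      have "KS.source_dom u \<subseteq> KS.source_dom v"
        by (rule KS.source_dom_mono) (use v(2) in \<open>simp add: down_def\<close>)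
      also have "\<dots> \<subseteq> (\<Union>u\<in>F. KS.source_dom u)" using v(1) by (rule UN_upper)
      finally show "KS.source_dom u \<subseteq> (\<Union>u\<in>F. KS.source_dom u)" .
    qed
    show "(\<Union>u\<in>F. KS.source_dom u)
        \<subseteq> (\<Union>u\<in>nonempty_elements \<inter> down s \<inter> down t. KS.source_dom u)"
      by (rule UN_mono[OF F(2) order_refl])
  qed
  also have "closedin (KS_space X \<theta>) \<dots>"
  proof (rule closedin_Union)
    show "finite (KS.source_dom ` F)" using F(1) by (rule finite_imageI)
    show "closedin (KS_space X \<theta>) T" if "T \<in> KS.source_dom ` F" for T
      using that closedin_KS_dom[OF source_idempotent] by (elim imageE) simp
  qed
  finally show ?thesis .
qed

text \<open>Compactness yields the finite set \<open>F\<close>; that \<open>F\<close> dominates a given \<open>v\<close> is tested at a principal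
  point of \<open>v\<^sup>\<star> * v\<close>.\<close>

lemma finite_cover_if_closedin_agreement:
  assumes cl: "closedin (subtopology (KS_space X \<theta>) (KS.source_dom s \<inter> KS.source_dom t))
      (KS.agreement s t)"
  shows "\<exists>F. finite F \<and> F \<subseteq> nonempty_elements \<inter> down s \<inter> down t \<and>
    nonempty_elements \<inter> down s \<inter> down t \<subseteq> (\<Union>u\<in>F. down u)"
proof -
  let ?L = "nonempty_elements \<inter> down s \<inter> down t"
  have "closedin (KS_space X \<theta>) (KS.source_dom s \<inter> KS.source_dom t)"
    by (intro closedin_Int closedin_KS_dom[OF source_idempotent])
  with cl have "closedin (KS_space X \<theta>) (KS.agreement s t)"
    by (rule closedin_trans_full)
  moreover have "KS.agreement s t \<subseteq> KS.source_dom s"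
    using KS.agreement_subset by (rule order_trans) (rule Int_lower1)
  ultimately have "compactin (KS_space X \<theta>) (KS.agreement s t)"
    using closed_compactin[OF compactin_KS_dom[OF source_idempotent[of s]]] by simp
  moreover have "openin (KS_space X \<theta>) U" if "U \<in> KS.source_dom ` ?L" for U
    using that by (elim imageE) (simp only: KS.openin_source_dom)
  moreover have "KS.agreement s t \<subseteq> \<Union>(KS.source_dom ` ?L)"
    by (rule equalityD1[OF KS_agreement_eq])
  ultimately have "\<exists>\<F>. finite \<F> \<and> \<F> \<subseteq> KS.source_dom ` ?L \<and> KS.agreement s t \<subseteq> \<Union>\<F>"
    by (rule compactinD)
  then obtain \<F> where \<F>: "finite \<F>" "\<F> \<subseteq> KS.source_dom ` ?L" "KS.agreement s t \<subseteq> \<Union>\<F>"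
    by blast
  obtain F where F: "F \<subseteq> ?L" "finite F" "\<F> = KS.source_dom ` F"
    using finite_subset_image[OF \<F>(1,2)] by (elim exE conjE)
  have "?L \<subseteq> (\<Union>u\<in>F. down u)"
  proof (rule subsetI)
    fix v assume v: "v \<in> ?L"
    then have "act_dom \<theta> (v\<^sup>\<star> * v) \<noteq> {}" by simp
    then obtain x where "x \<in> act_dom \<theta> (v\<^sup>\<star> * v)" by (elim ex_in_conv[THEN iffD2, THEN exE])
    then obtain \<tau> where \<tau>: "\<tau> \<in> KS.source_dom v"
      "\<forall>f\<in>idempotents. \<tau> \<in> KS_dom f \<longrightarrow> v\<^sup>\<star> * v \<preceq> f"
      by (rule principal_point[OF source_idempotent])
    have "\<tau> \<in> KS.agreement s t" unfolding KS_agreement_eq using v \<tau>(1) by (rule UN_I)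
    with \<F>(3) have "\<tau> \<in> \<Union>(KS.source_dom ` F)" unfolding F(3) by (rule subsetD)
    then obtain u where u: "u \<in> F" "\<tau> \<in> KS.source_dom u" by (rule UN_E)
    have "v\<^sup>\<star> * v \<preceq> u\<^sup>\<star> * u" using bspec[OF \<tau>(2) source_idempotent] u(2) by (rule mp)
    moreover have "u \<preceq> s" using subsetD[OF F(1) u(1)] by (simp add: down_def)
    moreover have "v \<preceq> s" using v by (simp add: down_def)
    ultimately have "v \<in> down u" using natural_le_if_source_le[of u s v] by (simp add: down_def)
    with u(1) show "v \<in> (\<Union>u\<in>F. down u)" by (rule UN_I)
  qed
  with F(1,2) show ?thesis by (intro exI[of _ F] conjI)
qed

theorem Hausdorff_KS_germs_iff:
  "Hausdorff_space (germ_topology (KS_space X \<theta>) (KS_action X \<theta>)) \<longleftrightarrow>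
    weak_semilattice nonempty_elements"
  unfolding KS.Hausdorff_germ_topology_iff[OF Hausdorff_KS_space]
proof
  assume "\<forall>s t. closedin (subtopology (KS_space X \<theta>) (KS.source_dom s \<inter> KS.source_dom t))
    (KS.agreement s t)"
  then show "weak_semilattice nonempty_elements"
    unfolding weak_semilattice_def
    by (intro ballI finite_cover_if_closedin_agreement) (elim allE)
next
  assume ws: "weak_semilattice nonempty_elements"
  show "\<forall>s t. closedin (subtopology (KS_space X \<theta>) (KS.source_dom s \<inter> KS.source_dom t))
    (KS.agreement s t)"
  proof (intro allI)
    fix s t
    have "closedin (KS_space X \<theta>) (KS.agreement s t)"
    proof (cases "s \<in> nonempty_elements \<and> t \<in> nonempty_elements")
      case True
      let ?L = "nonempty_elements \<inter> down s \<inter> down t"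
      from True ws have "\<exists>F. finite F \<and> F \<subseteq> ?L \<and> ?L \<subseteq> (\<Union>u\<in>F. down u)"
        unfolding weak_semilattice_def by (elim conjE) (drule (1) bspec, drule (1) bspec)
      then show ?thesis
        by (elim exE conjE) (rule closedin_agreement_if_finite_cover)
    next
      case False
      then have "KS.agreement s t = {}"
        using KS_dom_eq_empty_iff[OF source_idempotent[of s]]
          KS_dom_eq_empty_iff[OF source_idempotent[of t]] KS.agreement_subset[of s t] by auto
      then show ?thesis by simp
    qed
    then show "closedin (subtopology (KS_space X \<theta>) (KS.source_dom s \<inter> KS.source_dom t))
        (KS.agreement s t)"
      by (rule closedin_subset_topspace[OF _ KS.agreement_subset])
  qed
qed

end


section \<open>The KS-groupoid\<close>

theorem theorem3p1p3:
  fixes X :: "'x topology" and \<theta> :: "'s::inverse_semigroup \<Rightarrow> 'x \<rightharpoonup> 'x"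
  assumes "locally_compact_space X" and "Hausdorff_space X"
    and "semigroup_action X \<theta>"
    and "\<And>e. e \<in> idempotents \<Longrightarrow> compactin X (act_dom \<theta> e)"
  shows "Hausdorff_space (arrow_space (KS_groupoid X \<theta>)) \<longleftrightarrow>
    weak_semilattice {s. act_dom \<theta> (s\<^sup>\<star> * s) \<noteq> {}}"
proof -
  interpret compact_action X \<theta> by unfold_locales (use assms in auto)
  show ?thesis
    using Hausdorff_KS_germs_iff by (simp add: KS_groupoid_def transformation_groupoid_def)
qed

end
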